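(* Let $k_{-1},k_0,k_1$ be nonnegative integers, $n=k_{-1}+k_0+k_1$, and let $t$ be an integer. Let $t_1$, $m_{\beta}$ ($\beta\in\{-1,0,1\}$) and $m_{\alpha,\beta}$ ($\alpha,\beta\in\{-1,0,1\}$) be nonnegative integers such that $t_1\le t$ and $$m_{-1}+m_0+m_1=n,$$ $$m_{\alpha,-1}+m_{\alpha,0}+m_{\alpha,1}=k_\alpha\quad\text{for all }\alpha\in\{-1,0,1\},$$ $$m_{-1,\beta}+m_{0,\beta}+m_{1,\beta}=m_\beta\quad\text{for all }\beta\in\{-1,0,1\},$$ $$\sum_{\beta=-1}^{1}\mathrm{mdp}(m_{-1,\beta},m_{0,\beta},m_{1,\beta})>t,$$ $$t_1+2\min(E_1,E_2,E_3)+2(m_{1,0}+m_{-1,0})\le t,$$ where $$E_1=2\min(m_{-1},m_1),$$ $$E_2=\min(m_{-1,1},m_{-1,-1})+\min(m_{1,1},m_{1,-1})+\min(m_{-1},m_1),$$ $$E_3=\min(m_{-1,1},m_{-1,-1})+\min(m_{1,1},m_{1,-1})+\min(m_{1,1}+m_{-1,-1},\,m_{-1,1}+m_{1,-1})+m_{0,1}+m_{0,-1}.$$ Let $s$ be an integer with $t_1<s<m_{-1}+m_1$, and suppose that $t-2(m_{1,0}+m_{-1,0})\ge 0$. Write $M=m_{1,1}+m_{1,-1}+m_{-1,-1}+m_{-1,1}$ and $$R=\max_{m_{-1}+m_1-m_0\,\le\, l\,\le\,\min(s+4\min(m_{-1},m_1),\;m_{-1}+m_1)}\ \sum_{j=t-2(m_{1,0}+m_{-1,0})}^{l}\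 \sum_{i=0}^{j}\binom{l}{j}\binom{j}{i}\binom{m_{-1}+m_1-l}{M-j}\binom{M-j}{m_{1,1}+m_{1,-1}-i},$$ the maximum being over integers $l$. Then $$m(n,k_{-1},k_0,k_1,t)\ \ge\ h(n,m_{-1},m_0,m_1,s)\left(\prod_{\beta=-1}^{1}\binom{m_\beta}{m_{-1,\beta}}\binom{m_{0,\beta}+m_{1,\beta}}{m_{0,\beta}}-h(n,m_{-1},m_0,m_1,s)\binom{m_0}{m_{-1,0}}\binom{m_{0,0}+m_{1,0}}{m_{0,0}}R\right).$$
   Context: For nonnegative integers $a_{-1},a_0,a_1$ with $a_{-1}+a_0+a_1=N$, $V_N(a_{-1},a_0,a_1)$ is the set of vectors in $\{-1,0,1\}^N$ having exactly $a_{-1}$ coordinates equal to $-1$, $a_0$ equal to $0$ and $a_1$ equal to $1$. $(\mathbf x,\mathbf y)$ denotes the standard dot product. For an integer $c$: $m(N,a_{-1},a_0,a_1,c)$ is the maximum of $|W|$ over $W\subset V_N(a_{-1},a_0,a_1)$ with $(\mathbf x,\mathbf y)\neq c$ for all distinct $\mathbf x,\mathbf y\in W$; $h(N,a_{-1},a_0,a_1,c)$ is the maximum of $|W|$ over $W\subset V_N(a_{-1},a_0,a_1)$ with $(\mathbf x,\mathbf y)<c$ for all distinct $\mathbf x,\mathbf y\in W$. $\mathrm{mdp}(a_{-1},a_0,a_1)$ is the minimum of $(\mathbf x,\mathbf y)$ over $\mathbf x,\mathbf y\in V_N(a_{-1},a_0,a_1)$ (not necessarily distinct); explicitly, it equals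 $-2\min(a_{-1},a_1)$ if $a_0\ge\max(a_{-1},a_1)-\min(a_{-1},a_1)$, and $\max(a_{-1},a_1)-3\min(a_{-1},a_1)-a_0$ otherwise. Conventions: $\binom{a}{b}=0$ unless $0\le b\le a$; a sum over an empty range is $0$; a maximum over an empty range is $0$. *)

theory Defs
  imports Main "HOL-Library.FuncSet"
begin

text \<open>Vectors of length \<open>N\<close> are extensional functions on \<open>{..<N}\<close>.\<close>

definition V :: "nat \<Rightarrow> nat \<Rightarrow> nat \<Rightarrow> nat \<Rightarrow> (nat \<Rightarrow> int) set" where
  "V N am a0 ap = {x \<in> {..<N} \<rightarrow>\<^sub>E {-1, 0, 1}.
     card {i \<in> {..<N}. x i = -1} = am \<and>
     card {i \<in> {..<N}. x i = 0} = a0 \<and>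
     card {i \<in> {..<N}. x i = 1} = ap}"

definition dot :: "nat \<Rightarrow> (nat \<Rightarrow> int) \<Rightarrow> (nat \<Rightarrow> int) \<Rightarrow> int" where
  "dot N x y = (\<Sum>i<N. x i * y i)"

definition max_avoiding :: "nat \<Rightarrow> nat \<Rightarrow> nat \<Rightarrow> nat \<Rightarrow> int \<Rightarrow> nat" where
  "max_avoiding N am a0 ap c =
     Max {card W |W. W \<subseteq> V N am a0 ap \<and> (\<forall>x\<in>W. \<forall>y\<in>W. x \<noteq> y \<longrightarrow> dot N x y \<noteq> c)}"

definition max_below :: "nat \<Rightarrow> nat \<Rightarrow> nat \<Rightarrow> nat \<Rightarrow> int \<Rightarrow> nat" where
  "max_below N am a0 ap c =
     Max {card W |W. W \<subseteq> V N am a0 ap \<and> (\<forall>x\<in>W. \<forall>y\<in>W. x \<noteq> y \<longrightarrow> dot N x y < c)}"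

definition mdp :: "nat \<Rightarrow> nat \<Rightarrow> nat \<Rightarrow> int" where
  "mdp am a0 ap =
     (let N = am + a0 + ap
      in Min {dot N x y |x y. x \<in> V N am a0 ap \<and> y \<in> V N am a0 ap})"

text \<open>
  Binomial coefficients of integers that vanish unless \<open>0 \<le> b \<le> a\<close>; the library's
  \<open>gchoose\<close> is different, being nonzero for negative \<open>a\<close>.
\<close>

definition ibinom :: "int \<Rightarrow> int \<Rightarrow> int" where
  "ibinom a b = (if 0 \<le> b \<and> b \<le> a then int (nat a choose nat b) else 0)"

definition max_over :: "int set \<Rightarrow> (int \<Rightarrow> int) \<Rightarrow> int" where
  "max_over A f = (if A = {} then 0 else Max (f ` A))"

text \<open>The maxima and the minimum above are taken over finite nonempty sets.\<close>

lemma finite_V: "finite (V N am a0 ap)"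
  unfolding V_def by (simp add: finite_PiE)

lemma finite_cards: "finite {card W |W. W \<subseteq> V N am a0 ap \<and> P W}"
  using finite_V by simp

lemma cards_nonempty:
  "{card W |W. W \<subseteq> V N am a0 ap \<and> (\<forall>x\<in>W. \<forall>y\<in>W. x \<noteq> y \<longrightarrow> Q x y)} \<noteq> {}"
  by blast

lemma finite_dots: "finite {dot N x y |x y. x \<in> V N am a0 ap \<and> y \<in> V N am a0 ap}"
proof -
  have "{dot N x y |x y. x \<in> V N am a0 ap \<and> y \<in> V N am a0 ap}
      = (\<lambda>(x, y). dot N x y) ` (V N am a0 ap \<times> V N am a0 ap)"
    by auto
  then show ?thesis by (simp add: finite_V)
qed

lemma V_nonempty: "V (am + a0 + ap) am a0 ap \<noteq> {}"
proof -
  let ?N = "am + a0 + ap"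
  define x :: "nat \<Rightarrow> int" where
    "x = (\<lambda>i\<in>{..<?N}. if i < am then -1 else if i < am + a0 then 0 else 1)"
  have "{i \<in> {..<?N}. x i = -1} = {..<am}"
    and "{i \<in> {..<?N}. x i = 0} = {am..<am + a0}"
    and "{i \<in> {..<?N}. x i = 1} = {am + a0..<?N}"
    by (auto simp: x_def split: if_splits)
  moreover have "x \<in> {..<?N} \<rightarrow>\<^sub>E {-1, 0, 1}"
    by (auto simp: x_def)
  ultimately have "x \<in> V ?N am a0 ap"
    by (simp add: V_def)
  then show ?thesis by blast
qed

end

theory Submission imports Defs begin

text \<open>
  Take an optimal family \<open>W\<close> for \<open>max_below\<close> and replace each \<open>w \<in> W\<close> by the cluster of all
  \<open>x\<close> that have exactly \<open>mm \<alpha> \<beta>\<close> coordinates equal to \<open>\<alpha>\<close> among those where \<open>w\<close> equals \<open>\<beta>\<close>.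
  Inside one cluster all products exceed \<open>t\<close>, since each block contributes at least its \<open>mdp\<close>.
  If \<open>x\<close> and \<open>y\<close> from the clusters of \<open>w \<noteq> w'\<close> have product at least \<open>t\<close>, then \<open>x\<close> has at least
  \<open>t - 2 (mm 1 0 + mm (-1) 0)\<close> nonzero coordinates on the common support of \<open>w\<close> and \<open>w'\<close>. Deleting
  from every cluster the vectors with this property for some \<open>w'\<close> leaves disjoint sets whose union
  avoids \<open>t\<close>. The deleted vectors are counted by \<open>R\<close>, where \<open>l\<close> is the size of the common support,
  \<open>j\<close> the number of nonzero coordinates there and \<open>i\<close> the number of ones among them.
\<close>

section \<open>Counting ternary functions\<close>

text \<open>Supports and ones are recorded instead of all three values because \<open>j\<close> and
  \<open>i\<close> in \<open>R\<close> count exactly these. No relation between \<open>a\<close>,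
  \<open>b\<close> and \<open>card A\<close> has to be assumed.\<close>

definition shape :: "'a set \<Rightarrow> nat \<Rightarrow> nat \<Rightarrow> ('a \<Rightarrow> int) set" where
  "shape A a b = {f \<in> A \<rightarrow>\<^sub>E {-1, 0, 1}. card {i \<in> A. f i \<noteq> 0} = a \<and> card {i \<in> A. f i = 1} = b}"

lemma finite_shape: "finite A \<Longrightarrow> finite (shape A a b)"
  unfolding shape_def by (simp add: finite_PiE)

text \<open>A function is determined by its support and the set of its ones: choose an
  \<open>a\<close>-set in \<open>A\<close>, then a \<open>b\<close>-set inside it. For impossible
  \<open>a\<close> or \<open>b\<close> both sides vanish.\<close>

lemma card_shape:
  assumes "finite A"
  shows "card (shape A a b) = (card A choose a) * (a choose b)"
proof -
  define D where "D = (SIGMA S:{S. S \<subseteq> A \<and> card S = a}. {T. T \<subseteq> S \<and> card T = b})"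
  define g where
    "g = (\<lambda>(S, T). \<lambda>i\<in>A. if i \<in> T then 1 else if i \<in> S then - 1 else (0::int))"
  have "bij_betw (\<lambda>f. ({i \<in> A. f i \<noteq> 0}, {i \<in> A. f i = 1})) (shape A a b) D"
  proof (rule bij_betw_byWitness[where f' = g])
    show "\<forall>f\<in>shape A a b. g ({i \<in> A. f i \<noteq> 0}, {i \<in> A. f i = 1}) = f"
    proof
      fix f assume "f \<in> shape A a b"
      then have f: "f \<in> A \<rightarrow>\<^sub>E {-1, 0, 1}" by (simp add: shape_def)
      show "g ({i \<in> A. f i \<noteq> 0}, {i \<in> A. f i = 1}) = f"
      proof
        fix i show "g ({i \<in> A. f i \<noteq> 0}, {i \<in> A. f i = 1}) i = f i"
        proof (cases "i \<in> A")
          case True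
          with f have "f i \<in> {-1, 0, 1}" by (auto simp: PiE_def)
          with True show ?thesis by (auto simp: g_def)
        next
          case False
          with f show ?thesis by (auto simp: g_def PiE_def extensional_def)
        qed
      qed
    qed
    have g_sets: "{i \<in> A. g (S, T) i \<noteq> 0} = S" "{i \<in> A. g (S, T) i = 1} = T"
      if "S \<subseteq> A" "T \<subseteq> S" for S T
      using that by (auto simp: g_def split: if_splits)
    show "\<forall>d\<in>D. ({i \<in> A. g d i \<noteq> 0}, {i \<in> A. g d i = 1}) = d"
      by (auto simp: D_def g_sets)
    show "(\<lambda>f. ({i \<in> A. f i \<noteq> 0}, {i \<in> A. f i = 1})) ` shape A a b \<subseteq> D"
      by (auto simp: D_def shape_def)
    show "g ` D \<subseteq> shape A a b"
    proof
      fix f assume "f \<in> g ` D"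
      then obtain S T where f: "f = g (S, T)"
        and ST: "S \<subseteq> A" "T \<subseteq> S" "card S = a" "card T = b"
        by (auto simp: D_def)
      have "f \<in> A \<rightarrow>\<^sub>E {-1, 0, 1}" by (auto simp: f g_def)
      then show "f \<in> shape A a b"
        using ST by (simp add: shape_def f g_sets)
    qed
  qed
  then have "card (shape A a b) = card D" by (rule bij_betw_same_card)
  also have "\<dots> = (\<Sum>S | S \<subseteq> A \<and> card S = a. card {T. T \<subseteq> S \<and> card T = b})"
    unfolding D_def using assms by (subst card_SigmaI) (auto dest: finite_subset)
  also have "\<dots> = (\<Sum>S | S \<subseteq> A \<and> card S = a. a choose b)"
    using assms by (intro sum.cong refl) (auto simp: n_subsets dest: finite_subset)
  also have "\<dots> = (card A choose a) * (a choose b)"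
    using assms by (simp add: n_subsets)
  finally show ?thesis .
qed

definition ternary :: "'a set \<Rightarrow> nat \<Rightarrow> nat \<Rightarrow> nat \<Rightarrow> ('a \<Rightarrow> int) set" where
  "ternary A p z q = {f \<in> A \<rightarrow>\<^sub>E {-1, 0, 1}.
     card {i \<in> A. f i = -1} = p \<and> card {i \<in> A. f i = 0} = z \<and> card {i \<in> A. f i = 1} = q}"

lemma V_eq_ternary: "V N p z q = ternary {..<N} p z q"
  by (simp add: V_def ternary_def)

lemma finite_ternary: "finite A \<Longrightarrow> finite (ternary A p z q)"
  unfolding ternary_def by (simp add: finite_PiE)

lemma card_nonzero:
  fixes f :: "'a \<Rightarrow> int"
  assumes "finite A" "f \<in> A \<rightarrow> {-1, 0, 1}"
  shows "card {i \<in> A. f i \<noteq> 0} = card {i \<in> A. f i = -1} + card {i \<in> A. f i = 1}"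
proof -
  have "{i \<in> A. f i \<noteq> 0} = {i \<in> A. f i = -1} \<union> {i \<in> A. f i = 1}"
    using assms(2) by fastforce
  then show ?thesis using assms(1) by (simp add: card_Un_disjoint disjoint_iff)
qed

lemma card_zero_nonzero:
  fixes f :: "'a \<Rightarrow> int"
  assumes "finite A"
  shows "card {i \<in> A. f i = 0} + card {i \<in> A. f i \<noteq> 0} = card A"
proof -
  have "card ({i \<in> A. f i = 0} \<union> {i \<in> A. f i \<noteq> 0})
      = card {i \<in> A. f i = 0} + card {i \<in> A. f i \<noteq> 0}"
    using assms by (intro card_Un_disjoint) auto
  moreover have "{i \<in> A. f i = 0} \<union> {i \<in> A. f i \<noteq> 0} = A" by auto
  ultimately show ?thesis by simp
qed

lemma ternary_eq_shape:
  assumes "finite A" "card A = p + z + q"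
  shows "ternary A p z q = shape A (p + q) q"
  unfolding ternary_def shape_def
proof (rule Collect_cong)
  fix f :: "'a \<Rightarrow> int"
  show "(f \<in> A \<rightarrow>\<^sub>E {-1, 0, 1} \<and> card {i \<in> A. f i = -1} = p \<and> card {i \<in> A. f i = 0} = z
          \<and> card {i \<in> A. f i = 1} = q)
      \<longleftrightarrow> (f \<in> A \<rightarrow>\<^sub>E {-1, 0, 1} \<and> card {i \<in> A. f i \<noteq> 0} = p + q \<and> card {i \<in> A. f i = 1} = q)"
    using card_nonzero[of A f] card_zero_nonzero[of A f] assms by (auto simp: PiE_def)
qed

text \<open>Two factorizations of one multinomial coefficient: \<open>shape\<close> picks the
  support first and then the ones, while the theorem picks the places of -1 first and then the zeros
  among the rest.\<close>

lemma card_ternary: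
  assumes "finite A" "card A = p + z + q"
  shows "card (ternary A p z q) = (card A choose p) * ((z + q) choose z)"
proof -
  have "card (ternary A p z q) = (card A choose (p + q)) * ((p + q) choose q)"
    using assms by (simp add: ternary_eq_shape card_shape)
  also have "\<dots> = (card A choose p) * ((z + q) choose z)"
    using choose_mult_lemma[of q z p] binomial_symmetric[of p "p + q"]
      binomial_symmetric[of z "z + q"]
    by (simp add: assms(2) add.commute add.left_commute)
  finally show ?thesis .
qed

text \<open>Choices on disjoint sets are independent, as restriction to the two parts is a
  bijection. Applied twice, this counts a cluster block by block.\<close>

lemma card_glue:
  fixes X :: "'b set"
  assumes "A \<inter> B = {}" "F \<subseteq> A \<rightarrow>\<^sub>E X" "G \<subseteq> B \<rightarrow>\<^sub>E X"
  shows "card {f \<in> A \<union> B \<rightarrow>\<^sub>E X. restrict f A \<in> F \<and> restrict f B \<in> G} = card F * card G"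
proof -
  let ?S = "{f \<in> A \<union> B \<rightarrow>\<^sub>E X. restrict f A \<in> F \<and> restrict f B \<in> G}"
  define g where "g = (\<lambda>(u, v). \<lambda>i\<in>A \<union> B. if i \<in> A then u i else v i :: 'b)"
  have restrict_g: "restrict (g (u, v)) A = u" "restrict (g (u, v)) B = v"
    if "u \<in> F" "v \<in> G" for u v
  proof -
    have "u \<in> extensional A" "v \<in> extensional B"
      using that assms by (auto simp: PiE_def)
    then show "restrict (g (u, v)) A = u" "restrict (g (u, v)) B = v"
      using assms(1) by (auto simp: g_def restrict_def extensional_def fun_eq_iff)
  qed
  have "bij_betw (\<lambda>f. (restrict f A, restrict f B)) ?S (F \<times> G)"
  proof (rule bij_betw_byWitness[where f' = g])
    show "\<forall>f\<in>?S. g (restrict f A, restrict f B) = f"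
      by (auto simp: g_def restrict_def PiE_def extensional_def fun_eq_iff)
    show "\<forall>d\<in>F \<times> G. (restrict (g d) A, restrict (g d) B) = d"
      by (auto simp: restrict_g)
    show "g ` (F \<times> G) \<subseteq> ?S"
    proof
      fix f assume "f \<in> g ` (F \<times> G)"
      then obtain u v where uv: "u \<in> F" "v \<in> G" "f = g (u, v)" by auto
      then have "u \<in> A \<rightarrow>\<^sub>E X" "v \<in> B \<rightarrow>\<^sub>E X" using assms by auto
      then have "f \<in> A \<union> B \<rightarrow>\<^sub>E X" unfolding uv(3) g_def by auto
      then show "f \<in> ?S" using uv by (simp add: restrict_g)
    qed
  qed auto
  then show ?thesis by (simp add: bij_betw_same_card card_cartesian_product)
qed

lemma card_restrict: "card {i \<in> A. restrict f A i = c} = card {i \<in> A. f i = c}"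
  by (metis (mono_tags, lifting) restrict_apply')

lemma restrict_in_ternary:
  "f \<in> A \<rightarrow> {-1, 0, 1} \<Longrightarrow> restrict f A \<in> ternary A p z q \<longleftrightarrow>
     card {i \<in> A. f i = -1} = p \<and> card {i \<in> A. f i = 0} = z \<and> card {i \<in> A. f i = 1} = q"
  by (simp add: ternary_def restrict_PiE_iff Pi_iff card_restrict del: restrict_apply)

lemma restrict_in_shape:
  assumes "f \<in> A \<rightarrow> {-1, 0, 1}"
  shows "restrict f A \<in> shape A (card {i \<in> A. f i \<noteq> 0}) (card {i \<in> A. f i = 1})"
proof -
  have "{i \<in> A. restrict f A i \<noteq> 0} = {i \<in> A. f i \<noteq> 0}" by auto
  then show ?thesis
    using assms
    by (simp add: shape_def restrict_PiE_iff Pi_iff card_restrict del: restrict_apply)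
qed

section \<open>Integer binomials and maxima with default values\<close>

lemma ibinom_int: "ibinom (int a) (int b) = int (a choose b)"
  by (simp add: ibinom_def binomial_eq_0)

lemma ibinom_nonneg: "ibinom a b \<ge> 0"
  by (simp add: ibinom_def)

lemma max_over_ge: "finite A \<Longrightarrow> a \<in> A \<Longrightarrow> f a \<le> max_over A f"
  by (auto simp: max_over_def)

text \<open>The empty range is covered by the default value 0. This gives the sign of
  \<open>R\<close> whether or not some \<open>l\<close> is admissible.\<close>

lemma max_over_nonneg:
  assumes "finite A" "\<And>a. a \<in> A \<Longrightarrow> 0 \<le> f a"
  shows "0 \<le> max_over A f"
proof (cases "A = {}")
  case False
  then obtain a where "a \<in> A" by blast
  then show ?thesis using max_over_ge[of A a f] assms by force
qed (simp add: max_over_def)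

section \<open>Scalar products\<close>

text \<open>\<open>mdp\<close> is defined over the index set \<open>{..<N}\<close>, but blocks are
  arbitrary finite sets; a bijection between the two index sets preserves both compositions and
  products.\<close>

lemma mdp_le_sum:
  assumes "finite A" "card A = p + z + q" "x \<in> ternary A p z q" "y \<in> ternary A p z q"
  shows "mdp p z q \<le> (\<Sum>i\<in>A. x i * y i)"
proof -
  let ?N = "p + z + q"
  obtain h where h: "bij_betw h {..<?N} A"
    using assms ex_bij_betw_nat_finite[of A] by (auto simp: lessThan_atLeast0)
  have transport: "restrict (u \<circ> h) {..<?N} \<in> V ?N p z q" if "u \<in> ternary A p z q" for u
  proof -
    have u: "u \<in> A \<rightarrow> {-1, 0, 1}" using that by (auto simp: ternary_def PiE_def)
    have "card {i \<in> {..<?N}. (u \<circ> h) i = c} = card {i \<in> A. u i = c}" for c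
    proof (rule bij_betw_same_card)
      show "bij_betw h {i \<in> {..<?N}. (u \<circ> h) i = c} {i \<in> A. u i = c}"
        using h by (auto simp: bij_betw_def inj_on_def)
    qed
    moreover have "u \<circ> h \<in> {..<?N} \<rightarrow> {-1, 0, 1}"
      using u bij_betwE[OF h] by fastforce
    ultimately show ?thesis
      unfolding V_eq_ternary using that by (subst restrict_in_ternary) (auto simp: ternary_def)
  qed
  have "(\<Sum>i\<in>A. x i * y i) = (\<Sum>i<?N. x (h i) * y (h i))"
    by (rule sum.reindex_bij_betw[OF h, symmetric])
  also have "\<dots> = dot ?N (restrict (x \<circ> h) {..<?N}) (restrict (y \<circ> h) {..<?N})"
    unfolding dot_def by (intro sum.cong) auto
  finally have "(\<Sum>i\<in>A. x i * y i) \<in> {dot ?N x y |x y. x \<in> V ?N p z q \<and> y \<in> V ?N p z q}"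
    using transport assms by blast
  then show ?thesis unfolding mdp_def Let_def by (intro Min_le finite_dots)
qed

lemma card_eq_sum_of_bool: "finite A \<Longrightarrow> int (card {i \<in> A. P i}) = (\<Sum>i\<in>A. of_bool (P i))"
  by (simp add: sum.If_cases of_bool_def Int_def)

text \<open>On the common support a product is 1 or -1, so the size of that support exceeds the dot
  product by twice the number of opposite signs. Either order of opposite signs occurs at most
  \<open>min p q\<close> times. With \<open>dot n w w' < s\<close> this yields the upper limit for
  \<open>l\<close> in \<open>R\<close>.\<close>

lemma common_support_le:
  assumes w: "w \<in> V n p z q" and w': "w' \<in> V n p z q"
  shows "int (card {i \<in> {..<n}. w i \<noteq> 0 \<and> w' i \<noteq> 0}) \<le> dot n w w' + 4 * int (min p q)"
proof -
  have val: "w i \<in> {-1, 0, 1}" "w' i \<in> {-1, 0, 1}" if "i < n" for i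
    using w w' that by (auto simp: V_def PiE_def)
  have cards: "card {i \<in> {..<n}. w i = 1} = q" "card {i \<in> {..<n}. w i = -1} = p"
    "card {i \<in> {..<n}. w' i = 1} = q" "card {i \<in> {..<n}. w' i = -1} = p"
    using w w' by (auto simp: V_def)
  have a: "card {i \<in> {..<n}. w i = 1 \<and> w' i = -1} \<le> min p q"
    using card_mono[of "{i \<in> {..<n}. w i = 1}" "{i \<in> {..<n}. w i = 1 \<and> w' i = -1}"]
      card_mono[of "{i \<in> {..<n}. w' i = -1}" "{i \<in> {..<n}. w i = 1 \<and> w' i = -1}"] cards
    by auto
  have b: "card {i \<in> {..<n}. w i = -1 \<and> w' i = 1} \<le> min p q"
    using card_mono[of "{i \<in> {..<n}. w i = -1}" "{i \<in> {..<n}. w i = -1 \<and> w' i = 1}"]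
      card_mono[of "{i \<in> {..<n}. w' i = 1}" "{i \<in> {..<n}. w i = -1 \<and> w' i = 1}"] cards
    by auto
  have "int (card {i \<in> {..<n}. w i \<noteq> 0 \<and> w' i \<noteq> 0})
      = (\<Sum>i<n. of_bool (w i \<noteq> 0 \<and> w' i \<noteq> 0))"
    by (simp only: card_eq_sum_of_bool finite_lessThan)
  also have "\<dots> = (\<Sum>i<n. w i * w' i + 2 * of_bool (w i = 1 \<and> w' i = -1)
       + 2 * of_bool (w i = -1 \<and> w' i = 1))"
    by (intro sum.cong refl) (use val in fastforce)
  also have "\<dots> = dot n w w' + 2 * int (card {i \<in> {..<n}. w i = 1 \<and> w' i = -1})
      + 2 * int (card {i \<in> {..<n}. w i = -1 \<and> w' i = 1})"
    by (simp only: card_eq_sum_of_bool finite_lessThan sum.distrib sum_distrib_left dot_def)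
  also have "\<dots> \<le> dot n w w' + 4 * int (min p q)" using a b by linarith
  finally show ?thesis .
qed

lemma dot_le_card_support:
  assumes "x \<in> {..<n} \<rightarrow> {-1, 0, 1}" "y \<in> {..<n} \<rightarrow> {-1, 0, 1}"
  shows "dot n x y \<le> int (card {i \<in> {..<n}. x i \<noteq> 0 \<and> y i \<noteq> 0})"
proof -
  have "dot n x y \<le> (\<Sum>i<n. of_bool (x i \<noteq> 0 \<and> y i \<noteq> 0))"
    unfolding dot_def
  proof (rule sum_mono)
    fix i assume "i \<in> {..<n}"
    then have "x i \<in> {-1, 0, 1}" "y i \<in> {-1, 0, 1}" using assms by (blast dest: funcset_mem)+
    then show "x i * y i \<le> of_bool (x i \<noteq> 0 \<and> y i \<noteq> 0)" by auto
  qed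
  then show ?thesis by (simp only: card_eq_sum_of_bool finite_lessThan)
qed

section \<open>Clusters\<close>

definition cluster :: "nat \<Rightarrow> (int \<Rightarrow> int \<Rightarrow> nat) \<Rightarrow> (nat \<Rightarrow> int) \<Rightarrow> (nat \<Rightarrow> int) set" where
  "cluster n mm w = {x \<in> {..<n} \<rightarrow>\<^sub>E {-1, 0, 1}. \<forall>\<alpha>\<in>{-1, 0, 1}. \<forall>\<beta>\<in>{-1, 0, 1}.
     card {i \<in> {..<n}. w i = \<beta> \<and> x i = \<alpha>} = mm \<alpha> \<beta>}"

lemma cluster_values: "x \<in> cluster n mm w \<Longrightarrow> x \<in> {..<n} \<rightarrow> {-1, 0, 1}"
  by (auto simp: cluster_def PiE_def)

lemma finite_cluster: "finite (cluster n mm w)"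
  unfolding cluster_def by (simp add: finite_PiE)

lemma cluster_card:
  "x \<in> cluster n mm w \<Longrightarrow> \<alpha> \<in> {-1, 0, 1} \<Longrightarrow> \<beta> \<in> {-1, 0, 1} \<Longrightarrow>
     card {i \<in> {..<n}. w i = \<beta> \<and> x i = \<alpha>} = mm \<alpha> \<beta>"
  unfolding cluster_def by blast

lemma cluster_card_block:
  assumes "x \<in> cluster n mm w" "\<alpha> \<in> {-1, 0, 1}" "\<beta> \<in> {-1, 0, 1}"
  shows "card {i \<in> {i \<in> {..<n}. w i = \<beta>}. x i = \<alpha>} = mm \<alpha> \<beta>"
proof -
  have "{i \<in> {i \<in> {..<n}. w i = \<beta>}. x i = \<alpha>} = {i \<in> {..<n}. w i = \<beta> \<and> x i = \<alpha>}" by auto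
  then show ?thesis by (simp only: cluster_card[OF assms])
qed

lemma cluster_restrict:
  assumes "x \<in> cluster n mm w" "\<beta> \<in> {-1, 0, 1}"
  shows "restrict x {i \<in> {..<n}. w i = \<beta>}
      \<in> ternary {i \<in> {..<n}. w i = \<beta>} (mm (-1) \<beta>) (mm 0 \<beta>) (mm 1 \<beta>)"
proof -
  have "x \<in> {i \<in> {..<n}. w i = \<beta>} \<rightarrow> {-1, 0, 1}"
    using cluster_values[OF assms(1)] by auto
  then show ?thesis
    using cluster_card_block[OF assms(1) _ assms(2)] by (simp only: restrict_in_ternary) blast
qed

lemma interval_pm1: "{-1..1} = {-1, 0, 1::int}"
  by auto

lemma sum_over_blocks:
  fixes w :: "nat \<Rightarrow> int" and f :: "nat \<Rightarrow> 'b::comm_monoid_add"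
  assumes "w \<in> {..<n} \<rightarrow> {-1, 0, 1}"
  shows "sum f {..<n} = (\<Sum>\<beta>\<in>{-1..1}. sum f {i \<in> {..<n}. w i = \<beta>})"
  by (rule sum.group[symmetric]) (use assms in \<open>auto simp: interval_pm1\<close>)

text \<open>The coordinates where \<open>x\<close> equals \<alpha> are split by the value of
  \<open>w\<close>, so their number is a row sum of \<open>mm\<close>.\<close>

lemma cluster_subset_V:
  assumes w: "w \<in> {..<n} \<rightarrow> {-1, 0, 1}"
    and k: "\<forall>\<alpha>\<in>{-1, 0, 1}. mm \<alpha> (-1) + mm \<alpha> 0 + mm \<alpha> 1 = k \<alpha>"
  shows "cluster n mm w \<subseteq> V n (k (-1)) (k 0) (k 1)"
proof
  fix x assume x: "x \<in> cluster n mm w"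
  have "card {i \<in> {..<n}. x i = \<alpha>} = k \<alpha>" if \<alpha>: "\<alpha> \<in> {-1, 0, 1}" for \<alpha>
  proof -
    have "int (card {i \<in> {..<n}. x i = \<alpha>}) = (\<Sum>i<n. of_bool (x i = \<alpha>))"
      by (simp only: card_eq_sum_of_bool finite_lessThan)
    also have "\<dots> = (\<Sum>\<beta>\<in>{-1..1}. \<Sum>i | i \<in> {..<n} \<and> w i = \<beta>. of_bool (x i = \<alpha>))"
      by (rule sum_over_blocks[OF w])
    also have "\<dots> = (\<Sum>\<beta>\<in>{-1..1}. int (mm \<alpha> \<beta>))"
    proof (rule sum.cong[OF refl])
      fix \<beta> :: int assume \<beta>: "\<beta> \<in> {-1..1}"
      have "(\<Sum>i | i \<in> {..<n} \<and> w i = \<beta>. of_bool (x i = \<alpha>))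
          = int (card {i \<in> {i \<in> {..<n}. w i = \<beta>}. x i = \<alpha>})"
        by (rule card_eq_sum_of_bool[symmetric]) simp
      also have "\<dots> = int (mm \<alpha> \<beta>)"
        using cluster_card_block[OF x \<alpha>] \<beta> by (simp only: interval_pm1)
      finally show "(\<Sum>i | i \<in> {..<n} \<and> w i = \<beta>. of_bool (x i = \<alpha>)) = int (mm \<alpha> \<beta>)" .
    qed
    also have "\<dots> = int (k \<alpha>)"
      using bspec[OF k \<alpha>, symmetric] by (simp add: interval_pm1)
    finally show ?thesis by simp
  qed
  then show "x \<in> V n (k (-1)) (k 0) (k 1)"
    using x by (simp add: V_def cluster_def)
qed

section \<open>Products inside a cluster and the size of a cluster\<close>

lemma V_card:
  "w \<in> V n (m (-1)) (m 0) (m 1) \<Longrightarrow> \<beta> \<in> {-1, 0, 1} \<Longrightarrow> card {i \<in> {..<n}. w i = \<beta>} = m \<beta>"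
  by (auto simp: V_def)

text \<open>Split the product over the blocks of \<open>w\<close>. On each block \<open>x\<close>
  and \<open>y\<close> have the same composition, and the column sums match it to the block size, so
  \<open>mdp_le_sum\<close> applies.\<close>

lemma dot_within_cluster:
  assumes w: "w \<in> V n (m (-1)) (m 0) (m 1)"
    and m: "\<forall>\<beta>\<in>{-1, 0, 1}. mm (-1) \<beta> + mm 0 \<beta> + mm 1 \<beta> = m \<beta>"
    and xy: "x \<in> cluster n mm w" "y \<in> cluster n mm w"
  shows "(\<Sum>\<beta>\<in>{-1..1}. mdp (mm (-1) \<beta>) (mm 0 \<beta>) (mm 1 \<beta>)) \<le> dot n x y"
proof -
  have eq: "dot n x y = (\<Sum>\<beta>\<in>{-1..1}. \<Sum>i | i \<in> {..<n} \<and> w i = \<beta>. x i * y i)"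
    unfolding dot_def using w by (intro sum_over_blocks) (auto simp: V_def PiE_def)
  have "mdp (mm (-1) \<beta>) (mm 0 \<beta>) (mm 1 \<beta>) \<le> (\<Sum>i | i \<in> {..<n} \<and> w i = \<beta>. x i * y i)"
    if "\<beta> \<in> {-1..1}" for \<beta>
  proof -
    have \<beta>: "\<beta> \<in> {-1, 0, 1}" using that by (simp add: interval_pm1)
    let ?A = "{i \<in> {..<n}. w i = \<beta>}"
    have "card ?A = m \<beta>" by (rule V_card[OF w \<beta>])
    then have "card ?A = mm (-1) \<beta> + mm 0 \<beta> + mm 1 \<beta>"
      using bspec[OF m \<beta>] by (simp only:)
    then have "mdp (mm (-1) \<beta>) (mm 0 \<beta>) (mm 1 \<beta>) \<le> (\<Sum>i\<in>?A. restrict x ?A i * restrict y ?A i)"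
      by (intro mdp_le_sum cluster_restrict xy \<beta>) auto
    then show ?thesis by simp
  qed
  then show ?thesis unfolding eq by (rule sum_mono)
qed

lemma card_cluster:
  assumes w: "w \<in> V n (m (-1)) (m 0) (m 1)"
    and m: "\<forall>\<beta>\<in>{-1, 0, 1}. mm (-1) \<beta> + mm 0 \<beta> + mm 1 \<beta> = m \<beta>"
  shows "card (cluster n mm w)
      = (\<Prod>\<beta>\<in>{-1..1}. (m \<beta> choose mm (-1) \<beta>) * ((mm 0 \<beta> + mm 1 \<beta>) choose mm 0 \<beta>))"
proof -
  define A where "A \<beta> = {i \<in> {..<n}. w i = \<beta>}" for \<beta>
  define T where "T \<beta> = ternary (A \<beta>) (mm (-1) \<beta>) (mm 0 \<beta>) (mm 1 \<beta>)" for \<beta>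
  have w_val: "w i \<in> {-1, 0, 1}" if "i < n" for i
    using w that by (auto simp: V_def PiE_def)
  have union: "A (-1) \<union> (A 0 \<union> A 1) = {..<n}" using w_val by (auto simp: A_def)
  have T_sub: "T \<beta> \<subseteq> A \<beta> \<rightarrow>\<^sub>E {-1, 0, 1}" for \<beta> by (auto simp: T_def ternary_def)
  let ?G = "{f \<in> A 0 \<union> A 1 \<rightarrow>\<^sub>E {-1, 0, 1}. restrict f (A 0) \<in> T 0 \<and> restrict f (A 1) \<in> T 1}"
  \<comment> \<open>The cluster conditions for different \<beta> concern disjoint blocks, so
    membership is tested on each restriction separately.\<close>
  have in_cluster: "x \<in> cluster n mm w \<longleftrightarrow> (\<forall>\<beta>\<in>{-1, 0, 1}. restrict x (A \<beta>) \<in> T \<beta>)"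
    if "x \<in> {..<n} \<rightarrow>\<^sub>E {-1, 0, 1}" for x
  proof -
    have "restrict x (A \<beta>) \<in> T \<beta> \<longleftrightarrow> (\<forall>\<alpha>\<in>{-1, 0, 1}. card {i \<in> A \<beta>. x i = \<alpha>} = mm \<alpha> \<beta>)" for \<beta>
    proof -
      have "x \<in> A \<beta> \<rightarrow> {-1, 0, 1}" using that by (auto simp: A_def PiE_def)
      then show ?thesis unfolding T_def by (subst restrict_in_ternary) auto
    qed
    then show ?thesis using that unfolding cluster_def A_def by (auto simp: conj_assoc)
  qed
  \<comment> \<open>The nested union lets \<open>card_glue\<close> split off one block at a
    time.\<close>
  have cluster_eq: "cluster n mm w = {x \<in> A (-1) \<union> (A 0 \<union> A 1) \<rightarrow>\<^sub>E {-1, 0, 1}.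
      restrict x (A (-1)) \<in> T (-1) \<and> restrict x (A 0 \<union> A 1) \<in> ?G}"
    (is "_ = ?C")
  proof (rule set_eqI)
    fix x :: "nat \<Rightarrow> int"
    show "x \<in> cluster n mm w \<longleftrightarrow> x \<in> ?C"
    proof (cases "x \<in> {..<n} \<rightarrow>\<^sub>E {-1, 0, 1}")
      case True
      then have "restrict x (A 0 \<union> A 1) \<in> A 0 \<union> A 1 \<rightarrow>\<^sub>E {-1, 0, 1}"
        using union by (auto simp: PiE_def)
      then show ?thesis
        using True by (simp add: in_cluster union Int_absorb1)
    next
      case False
      then show ?thesis by (simp add: union cluster_def)
    qed
  qed
  have "card (cluster n mm w) = card (T (-1)) * card ?G"
    unfolding cluster_eq by (rule card_glue[OF _ T_sub]) (auto simp: A_def)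
  moreover have "card ?G = card (T 0) * card (T 1)"
    by (rule card_glue[OF _ T_sub T_sub]) (auto simp: A_def)
  ultimately have "card (cluster n mm w) = (\<Prod>\<beta>\<in>{-1..1}. card (T \<beta>))"
    by (simp add: interval_pm1)
  also have "\<dots> = (\<Prod>\<beta>\<in>{-1..1}. (m \<beta> choose mm (-1) \<beta>) * ((mm 0 \<beta> + mm 1 \<beta>) choose mm 0 \<beta>))"
  proof (rule prod.cong[OF refl])
    fix \<beta> :: int assume "\<beta> \<in> {-1..1}"
    then have \<beta>: "\<beta> \<in> {-1, 0, 1}" by (simp only: interval_pm1)
    have A: "card (A \<beta>) = m \<beta>" unfolding A_def by (rule V_card[OF w \<beta>])
    have "finite (A \<beta>)" "card (A \<beta>) = mm (-1) \<beta> + mm 0 \<beta> + mm 1 \<beta>"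
      unfolding bspec[OF m \<beta>] A by (auto simp: A_def)
    from card_ternary[OF this]
    show "card (T \<beta>) = (m \<beta> choose mm (-1) \<beta>) * ((mm 0 \<beta> + mm 1 \<beta>) choose mm 0 \<beta>)"
      unfolding T_def A .
  qed
  finally show ?thesis .
qed

section \<open>Vectors whose product with another cluster may reach \<open>t\<close>\<close>

lemma cluster_support_card:
  assumes "x \<in> cluster n mm w"
  shows "card {i \<in> {..<n}. w i = 0 \<and> x i \<noteq> 0} = mm 1 0 + mm (-1) 0"
proof -
  have "x \<in> {i \<in> {..<n}. w i = 0} \<rightarrow> {-1, 0, 1}"
    using cluster_values[OF assms] by auto
  from card_nonzero[OF _ this]
  have "card {i \<in> {i \<in> {..<n}. w i = 0}. x i \<noteq> 0} = mm (-1) 0 + mm 1 0"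
    using cluster_card_block[OF assms, of "-1" 0] cluster_card_block[OF assms, of 1 0] by simp
  then show ?thesis by (simp add: conj_assoc)
qed

text \<open>A coordinate where \<open>x\<close> and \<open>y\<close> are both nonzero lies in the
  common support of \<open>w\<close> and \<open>w'\<close>, or where \<open>w\<close> vanishes, or
  where \<open>w'\<close> vanishes. Each of the last two cases covers at most
  \<open>mm 1 0 + mm (-1) 0\<close> coordinates. The right side does not involve \<open>y\<close>,
  so the vectors to delete can be described by \<open>x\<close>, \<open>w\<close> and
  \<open>w'\<close> alone.\<close>

lemma dot_between_clusters:
  assumes x: "x \<in> cluster n mm w" and y: "y \<in> cluster n mm w'"
  shows "dot n x y - 2 * (int (mm 1 0) + int (mm (-1) 0))
      \<le> int (card {i \<in> {..<n}. (w i \<noteq> 0 \<and> w' i \<noteq> 0) \<and> x i \<noteq> 0})"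
proof -
  let ?A = "{i \<in> {..<n}. (w i \<noteq> 0 \<and> w' i \<noteq> 0) \<and> x i \<noteq> 0}"
  let ?B = "{i \<in> {..<n}. w i = 0 \<and> x i \<noteq> 0}"
  let ?C = "{i \<in> {..<n}. w' i = 0 \<and> y i \<noteq> 0}"
  have "card {i \<in> {..<n}. x i \<noteq> 0 \<and> y i \<noteq> 0} \<le> card (?A \<union> ?B \<union> ?C)"
    by (rule card_mono) auto
  also have "\<dots> \<le> card ?A + card ?B + card ?C"
    by (meson add_le_mono1 card_Un_le le_trans)
  also have "\<dots> = card ?A + 2 * (mm 1 0 + mm (-1) 0)"
    by (simp only: cluster_support_card[OF x] cluster_support_card[OF y] mult_2 add.assoc)
  finally have "int (card {i \<in> {..<n}. x i \<noteq> 0 \<and> y i \<noteq> 0})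
      \<le> int (card ?A + 2 * (mm 1 0 + mm (-1) 0))"
    by (rule of_nat_mono)
  from order_trans[OF dot_le_card_support[OF cluster_values[OF x] cluster_values[OF y]] this]
  show ?thesis by (simp only: diff_le_eq of_nat_add of_nat_mult of_nat_numeral)
qed

text \<open>Cut \<open>x\<close> into its parts on the zeros of \<open>w\<close>, on the common
  support and on the rest of the support of \<open>w\<close>. Fixing \<open>j\<close> and
  \<open>i\<close> on the common support forces the counts on the rest, since the totals on the
  support of \<open>w\<close> are the same throughout the cluster. Only an upper bound results: the
  separate counts for \<open>w i = 1\<close> and \<open>w i = -1\<close> are forgotten.\<close>

lemma card_shared_slice:
  fixes l :: int
  assumes w: "w \<in> V n (m (-1)) (m 0) (m 1)"
    and m: "\<forall>\<beta>\<in>{-1, 0, 1}. mm (-1) \<beta> + mm 0 \<beta> + mm 1 \<beta> = m \<beta>"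
    and l: "l = int (card {i \<in> {..<n}. w i \<noteq> 0 \<and> w' i \<noteq> 0})"
  shows "int (card {x \<in> cluster n mm w.
         int (card {i \<in> {..<n}. (w i \<noteq> 0 \<and> w' i \<noteq> 0) \<and> x i \<noteq> 0}) = j
       \<and> int (card {i \<in> {..<n}. (w i \<noteq> 0 \<and> w' i \<noteq> 0) \<and> x i = 1}) = i})
    \<le> int (m 0 choose mm (-1) 0) * int ((mm 0 0 + mm 1 0) choose mm 0 0)
      * (ibinom l j * ibinom j i
         * ibinom (int (m (-1)) + int (m 1) - l)
             (int (mm 1 1 + mm 1 (-1) + mm (-1) (-1) + mm (-1) 1) - j)
         * ibinom (int (mm 1 1 + mm 1 (-1) + mm (-1) (-1) + mm (-1) 1) - j)
             (int (mm 1 1) + int (mm 1 (-1)) - i))"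
    (is "int (card ?X) \<le> ?rhs")
\<comment> \<open>Arbitrary integers \<open>j\<close> and \<open>i\<close> are allowed, so an empty
  slice is settled by nonnegativity of the bound; a member of a nonempty slice makes them genuine
  counts.\<close>
proof (cases "?X = {}")
  case True
  have "0 \<le> ?rhs" by (intro mult_nonneg_nonneg ibinom_nonneg of_nat_0_le_iff)
  with True show ?thesis by (simp only: card.empty of_nat_0)
next
  case False
  define Z where "Z = {i \<in> {..<n}. w i = 0}"
  define L where "L = {i \<in> {..<n}. w i \<noteq> 0 \<and> w' i \<noteq> 0}"
  define L' where "L' = {i \<in> {..<n}. w i \<noteq> 0 \<and> w' i = 0}"
  define M where "M = mm 1 1 + mm 1 (-1) + mm (-1) (-1) + mm (-1) 1"
  define q where "q = mm 1 1 + mm 1 (-1)"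
  define a b where "a = nat j" and "b = nat i"
  have fin: "finite Z" "finite L" "finite L'" by (auto simp: Z_def L_def L'_def)
  have union: "Z \<union> L \<union> L' = {..<n}" by (auto simp: Z_def L_def L'_def)
  have w_val: "w \<in> {..<n} \<rightarrow> {-1, 0, 1}" using w by (auto simp: V_def PiE_def)
  have cardZ: "card Z = m 0" using w by (simp add: Z_def V_def)
  have "card {i \<in> {..<n}. w i \<noteq> 0} = m (-1) + m 1"
    using card_nonzero[OF _ w_val] w by (simp add: V_def)
  moreover have "{i \<in> {..<n}. w i \<noteq> 0} = L \<union> L'" by (auto simp: L_def L'_def)
  moreover have "L \<inter> L' = {}" by (auto simp: L_def L'_def)
  ultimately have cardLL': "card L + card L' = m (-1) + m 1"
    using fin by (simp add: card_Un_disjoint)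
  \<comment> \<open>The totals \<open>M\<close> (nonzero) and \<open>q\<close> (ones) of
    \<open>x\<close> on the support of \<open>w\<close> determine the counts on \<open>L'\<close>
    from those on \<open>L\<close>.\<close>
  have x_counts: "card {i \<in> L. x i \<noteq> 0} = a" "card {i \<in> L. x i = 1} = b" "int a = j" "int b = i"
      "a + card {i \<in> L'. x i \<noteq> 0} = M" "b + card {i \<in> L'. x i = 1} = q"
    if x: "x \<in> ?X" for x
  proof -
    have xc: "x \<in> cluster n mm w" using x by simp
    have split: "{i \<in> {..<n}. w i \<noteq> 0 \<and> P i} = {i \<in> L. P i} \<union> {i \<in> L'. P i}" for P
      by (auto simp: L_def L'_def)
    have card_split: "card {i \<in> {..<n}. w i \<noteq> 0 \<and> P i} = card {i \<in> L. P i} + card {i \<in> L'. P i}"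
      for P unfolding split by (rule card_Un_disjoint) (use fin in \<open>auto simp: L_def L'_def\<close>)
    show ja: "card {i \<in> L. x i \<noteq> 0} = a" "int a = j" "card {i \<in> L. x i = 1} = b" "int b = i"
      using x by (auto simp: L_def a_def b_def conj_assoc)
    have ones: "card {i \<in> {..<n}. w i \<noteq> 0 \<and> x i = \<alpha>} = mm \<alpha> (-1) + mm \<alpha> 1"
      if "\<alpha> \<in> {-1, 0, 1}" for \<alpha>
    proof -
      have "{i \<in> {..<n}. w i \<noteq> 0 \<and> x i = \<alpha>}
          = {i \<in> {..<n}. w i = -1 \<and> x i = \<alpha>} \<union> {i \<in> {..<n}. w i = 1 \<and> x i = \<alpha>}"
        using w_val by fastforce
      also have "card \<dots> = card {i \<in> {..<n}. w i = -1 \<and> x i = \<alpha>}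
          + card {i \<in> {..<n}. w i = 1 \<and> x i = \<alpha>}"
        by (rule card_Un_disjoint) auto
      finally show ?thesis
        using cluster_card[OF xc that, of "-1"] cluster_card[OF xc that, of 1] by simp
    qed
    show "b + card {i \<in> L'. x i = 1} = q"
      using card_split[of "\<lambda>i. x i = 1"] ones[of 1] ja by (simp add: q_def)
    have "x \<in> {i \<in> {..<n}. w i \<noteq> 0} \<rightarrow> {-1, 0, 1}" using cluster_values[OF xc] by auto
    from card_nonzero[OF _ this] have "card {i \<in> {..<n}. w i \<noteq> 0 \<and> x i \<noteq> 0} = M"
      using ones[of 1] ones[of "-1"] by (simp add: M_def conj_assoc)
    then show "a + card {i \<in> L'. x i \<noteq> 0} = M"
      using card_split[of "\<lambda>i. x i \<noteq> 0"] ja by simp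
  qed
  let ?T = "ternary Z (mm (-1) 0) (mm 0 0) (mm 1 0) \<times> shape L a b \<times> shape L' (M - a) (q - b)"
  \<comment> \<open>The three sets cover \<open>{..<n}\<close> and \<open>x\<close> is extensional,
    so the restrictions determine \<open>x\<close>.\<close>
  have "inj_on (\<lambda>x. (restrict x Z, restrict x L, restrict x L')) ?X"
  proof (rule inj_onI)
    fix x y
    assume x: "x \<in> ?X" and y: "y \<in> ?X"
      and eq: "(restrict x Z, restrict x L, restrict x L') = (restrict y Z, restrict y L, restrict y L')"
    show "x = y"
    proof
      fix i
      show "x i = y i"
      proof (cases "i < n")
        case True
        then have "i \<in> Z \<or> i \<in> L \<or> i \<in> L'" using union by blast
        then show ?thesis using eq by (metis Pair_inject restrict_apply')
      next
        case False
        then show ?thesis using x y by (auto simp: cluster_def PiE_def extensional_def)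
      qed
    qed
  qed
  moreover have "(\<lambda>x. (restrict x Z, restrict x L, restrict x L')) ` ?X \<subseteq> ?T"
  proof (rule image_subsetI)
    fix x assume x: "x \<in> ?X"
    then have xc: "x \<in> cluster n mm w" by simp
    have "x \<in> L \<rightarrow> {-1, 0, 1}" "x \<in> L' \<rightarrow> {-1, 0, 1}"
      using cluster_values[OF xc] by (auto simp: L_def L'_def)
    from this[THEN restrict_in_shape] cluster_restrict[OF xc, of 0] x_counts[OF x]
    show "(restrict x Z, restrict x L, restrict x L') \<in> ?T"
      by (auto simp: Z_def)
  qed
  ultimately have "card ?X \<le> card ?T"
    by (rule card_inj_on_le) (simp add: finite_ternary finite_shape fin)
  also have "\<dots> = (m 0 choose mm (-1) 0) * ((mm 0 0 + mm 1 0) choose mm 0 0)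
      * ((card L choose a) * (a choose b) * (card L' choose (M - a)) * ((M - a) choose (q - b)))"
    using m cardZ fin by (simp add: card_cartesian_product card_ternary card_shape)
  finally have le: "int (card ?X) \<le> int ((m 0 choose mm (-1) 0) * ((mm 0 0 + mm 1 0) choose mm 0 0)
      * ((card L choose a) * (a choose b) * (card L' choose (M - a)) * ((M - a) choose (q - b))))"
    by (rule of_nat_mono)
  \<comment> \<open>The witness gives \<open>a\<close> \<le> \<open>M\<close> and \<open>b\<close>
    \<le> \<open>q\<close>, so the natural subtractions are exact and every \<open>ibinom\<close>
    becomes an ordinary binomial.\<close>
  from False obtain x where "x \<in> ?X" by blast
  note c = x_counts[OF this]
  have M_j: "int M - j = int (M - a)"
    and q_i: "int (mm 1 1) + int (mm 1 (-1)) - i = int (q - b)"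
    and S_l: "int (m (-1)) + int (m 1) - l = int (card L')"
    and lji: "l = int (card L)" "j = int a" "i = int b"
    using c cardLL' l by (auto simp: q_def L_def)
  have "?rhs = int ((m 0 choose mm (-1) 0) * ((mm 0 0 + mm 1 0) choose mm 0 0)
      * ((card L choose a) * (a choose b) * (card L' choose (M - a)) * ((M - a) choose (q - b))))"
    unfolding M_def[symmetric] M_j q_i S_l unfolding lji ibinom_int by (simp only: of_nat_mult)
  with le show ?thesis by (simp only:)
qed

section \<open>The deletion argument\<close>

theorem mainTheorem3:
  fixes k m :: "int \<Rightarrow> nat" and mm :: "int \<Rightarrow> int \<Rightarrow> nat"
    and n t1 E1 E2 E3 M :: nat and t s R :: int
  assumes n: "n = k (-1) + k 0 + k 1"
    and t1: "int t1 \<le> t"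
    and m_sum: "m (-1) + m 0 + m 1 = n"
    and row_sums: "\<forall>\<alpha>\<in>{-1, 0, 1}. mm \<alpha> (-1) + mm \<alpha> 0 + mm \<alpha> 1 = k \<alpha>"
    and col_sums: "\<forall>\<beta>\<in>{-1, 0, 1}. mm (-1) \<beta> + mm 0 \<beta> + mm 1 \<beta> = m \<beta>"
    and mdp_sum: "(\<Sum>\<beta>\<in>{-1..1}. mdp (mm (-1) \<beta>) (mm 0 \<beta>) (mm 1 \<beta>)) > t"
    and E1: "E1 = 2 * min (m (-1)) (m 1)"
    and E2: "E2 = min (mm (-1) 1) (mm (-1) (-1)) + min (mm 1 1) (mm 1 (-1))
               + min (m (-1)) (m 1)"
    and E3: "E3 = min (mm (-1) 1) (mm (-1) (-1)) + min (mm 1 1) (mm 1 (-1))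
               + min (mm 1 1 + mm (-1) (-1)) (mm (-1) 1 + mm 1 (-1))
               + mm 0 1 + mm 0 (-1)"
    and E: "int t1 + 2 * int (min E1 (min E2 E3)) + 2 * (int (mm 1 0) + int (mm (-1) 0)) \<le> t"
    and s: "int t1 < s" "s < int (m (-1)) + int (m 1)"
    and t_ge: "t - 2 * (int (mm 1 0) + int (mm (-1) 0)) \<ge> 0"
    and M: "M = mm 1 1 + mm 1 (-1) + mm (-1) (-1) + mm (-1) 1"
    and R: "R = max_over
        {int (m (-1)) + int (m 1) - int (m 0)
          .. min (s + 4 * int (min (m (-1)) (m 1))) (int (m (-1)) + int (m 1))}
        (\<lambda>l. \<Sum>j = t - 2 * (int (mm 1 0) + int (mm (-1) 0))..l. \<Sum>i = 0..j.
           ibinom l j * ibinom j i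
           * ibinom (int (m (-1)) + int (m 1) - l) (int M - j)
           * ibinom (int M - j) (int (mm 1 1) + int (mm 1 (-1)) - i))"
  shows "int (max_avoiding n (k (-1)) (k 0) (k 1) t) \<ge>
      int (max_below n (m (-1)) (m 0) (m 1) s) *
        ((\<Prod>\<beta>\<in>{-1..1}. int (m \<beta> choose mm (-1) \<beta>)
             * int ((mm 0 \<beta> + mm 1 \<beta>) choose mm 0 \<beta>))
         - int (max_below n (m (-1)) (m 0) (m 1) s)
             * int (m 0 choose mm (-1) 0) * int ((mm 0 0 + mm 1 0) choose mm 0 0) * R)"
proof -
  define H where "H = max_below n (m (-1)) (m 0) (m 1) s"
  define K where "K = int (m 0 choose mm (-1) 0) * int ((mm 0 0 + mm 1 0) choose mm 0 0)"
  define S where "S = int (m (-1)) + int (m 1)"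
  define T where "T = t - 2 * (int (mm 1 0) + int (mm (-1) 0))"
  define P where "P = (\<Prod>\<beta>\<in>{-1..1}. int (m \<beta> choose mm (-1) \<beta>)
      * int ((mm 0 \<beta> + mm 1 \<beta>) choose mm 0 \<beta>))"
  define g where "g l j i = ibinom l j * ibinom j i * ibinom (S - l) (int M - j)
      * ibinom (int M - j) (int (mm 1 1) + int (mm 1 (-1)) - i)" for l j i
  define range where "range = {S - int (m 0) .. min (s + 4 * int (min (m (-1)) (m 1))) S}"
  have R': "R = max_over range (\<lambda>l. \<Sum>j = T..l. \<Sum>i = 0..j. g l j i)"
    unfolding R range_def g_def S_def T_def ..
  have g_nonneg: "g l j i \<ge> 0" for l j i by (simp add: g_def ibinom_nonneg)
  have R_nonneg: "R \<ge> 0"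
    unfolding R' by (rule max_over_nonneg) (auto simp: range_def intro!: sum_nonneg g_nonneg)
  have "H \<in> {card W |W. W \<subseteq> V n (m (-1)) (m 0) (m 1) \<and> (\<forall>x\<in>W. \<forall>y\<in>W. x \<noteq> y \<longrightarrow> dot n x y < s)}"
    unfolding H_def max_below_def by (intro Max_in finite_cards cards_nonempty)
  then obtain W where W: "W \<subseteq> V n (m (-1)) (m 0) (m 1)" "card W = H"
    and W_dot: "\<And>x y. x \<in> W \<Longrightarrow> y \<in> W \<Longrightarrow> x \<noteq> y \<Longrightarrow> dot n x y < s"
    by auto
  have finW: "finite W" using W(1) finite_V finite_subset by blast
  have w_val: "w \<in> {..<n} \<rightarrow> {-1, 0, 1}" if "w \<in> W" for w
    using W(1) that by (auto simp: V_def PiE_def)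

  \<comment> \<open>These are all \<open>x\<close> that \<open>dot_between_clusters\<close> allows
    to have product at least \<open>t\<close> with some vector of the cluster of
    \<open>w'\<close>.\<close>
  define bad where "bad w w' = {x \<in> cluster n mm w.
    T \<le> int (card {i \<in> {..<n}. (w i \<noteq> 0 \<and> w' i \<noteq> 0) \<and> x i \<noteq> 0})}" for w w' :: "nat \<Rightarrow> int"
  have bad_card: "int (card (bad w w')) \<le> K * R" if "w \<in> W" "w' \<in> W" "w \<noteq> w'" for w w'
  proof -
    define l where "l = int (card {i \<in> {..<n}. w i \<noteq> 0 \<and> w' i \<noteq> 0})"
    have wV: "w \<in> V n (m (-1)) (m 0) (m 1)" "w' \<in> V n (m (-1)) (m 0) (m 1)"
      using that W(1) by auto
    have supp: "int (card {i \<in> {..<n}. w i \<noteq> 0}) = S"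
      using card_nonzero[OF _ w_val[OF that(1)]] wV by (simp add: V_def S_def)
    have "l \<le> S"
      unfolding l_def supp[symmetric] by (intro of_nat_mono card_mono) auto
    moreover have "l \<le> s + 4 * int (min (m (-1)) (m 1))"
      using common_support_le[OF wV] W_dot[OF that] by (simp add: l_def)
    \<comment> \<open>Only the \<open>m 0\<close> zeros of \<open>w'\<close> can remove coordinates
      from the support of \<open>w\<close>.\<close>
    moreover have "S - int (m 0) \<le> l"
    proof -
      have "card {i \<in> {..<n}. w i \<noteq> 0}
          \<le> card ({i \<in> {..<n}. w i \<noteq> 0 \<and> w' i \<noteq> 0} \<union> {i \<in> {..<n}. w' i = 0})"
        by (rule card_mono) auto
      also have "\<dots> \<le> card {i \<in> {..<n}. w i \<noteq> 0 \<and> w' i \<noteq> 0} + card {i \<in> {..<n}. w' i = 0}"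
        by (rule card_Un_le)
      finally show ?thesis using supp wV by (simp add: l_def V_def)
    qed
    ultimately have l_range: "l \<in> range" by (simp add: range_def)
    define slice where "slice j i = {x \<in> cluster n mm w.
         int (card {i \<in> {..<n}. (w i \<noteq> 0 \<and> w' i \<noteq> 0) \<and> x i \<noteq> 0}) = j
       \<and> int (card {i \<in> {..<n}. (w i \<noteq> 0 \<and> w' i \<noteq> 0) \<and> x i = 1}) = i}" for j i
    have slice_card: "int (card (slice j i)) \<le> K * g l j i" for j i
      unfolding slice_def K_def g_def S_def M
      by (rule card_shared_slice[OF wV(1) col_sums l_def])
    \<comment> \<open>Sort the bad vectors by the numbers \<open>j\<close> of nonzero coordinates
      and \<open>i\<close> of ones on the common support.\<close>
    have "bad w w' \<subseteq> (\<Union>j\<in>{T..l}. \<Union>i\<in>{0..j}. slice j i)"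
    proof
      fix x assume x: "x \<in> bad w w'"
      let ?A = "{i \<in> {..<n}. (w i \<noteq> 0 \<and> w' i \<noteq> 0) \<and> x i \<noteq> 0}"
      let ?B = "{i \<in> {..<n}. (w i \<noteq> 0 \<and> w' i \<noteq> 0) \<and> x i = 1}"
      have "int (card ?A) \<in> {T..l}"
        using x by (auto simp: bad_def l_def intro!: card_mono)
      moreover have "int (card ?B) \<in> {0..int (card ?A)}"
        by (auto intro!: card_mono)
      moreover have "x \<in> slice (int (card ?A)) (int (card ?B))"
        using x by (simp add: bad_def slice_def)
      ultimately show "x \<in> (\<Union>j\<in>{T..l}. \<Union>i\<in>{0..j}. slice j i)" by blast
    qed
    moreover have fin: "finite (slice j i)" for j i
      by (simp add: slice_def finite_cluster)
    ultimately have "card (bad w w') \<le> card (\<Union>j\<in>{T..l}. \<Union>i\<in>{0..j}. slice j i)"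
      by (intro card_mono) auto
    also have "\<dots> \<le> (\<Sum>j = T..l. card (\<Union>i\<in>{0..j}. slice j i))"
      by (rule card_UN_le) simp
    also have "\<dots> \<le> (\<Sum>j = T..l. \<Sum>i = 0..j. card (slice j i))"
      by (intro sum_mono card_UN_le) simp
    finally have "int (card (bad w w')) \<le> (\<Sum>j = T..l. \<Sum>i = 0..j. int (card (slice j i)))"
      by (simp flip: of_nat_sum)
    also have "\<dots> \<le> (\<Sum>j = T..l. \<Sum>i = 0..j. K * g l j i)"
      by (intro sum_mono slice_card)
    also have "\<dots> = K * (\<Sum>j = T..l. \<Sum>i = 0..j. g l j i)"
      by (simp add: sum_distrib_left)
    also have "\<dots> \<le> K * R"
      unfolding R' by (intro mult_left_mono max_over_ge l_range) (auto simp: range_def K_def)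
    finally show ?thesis .
  qed

  define good where "good w = cluster n mm w - (\<Union>w'\<in>W - {w}. bad w w')" for w
  have good_card: "P - int H * (K * R) \<le> int (card (good w))" if w: "w \<in> W" for w
  proof -
    have "int (card (cluster n mm w)) = P"
      using w W(1) by (subst card_cluster[OF _ col_sums]) (auto simp: P_def)
    \<comment> \<open>The natural difference is at least the integer one, so the bound passes to the
      integers even if more is subtracted than is there.\<close>
    moreover have "card (cluster n mm w) - card (\<Union>w'\<in>W - {w}. bad w w') \<le> card (good w)"
      unfolding good_def by (rule diff_card_le_card_Diff) (simp add: finW bad_def finite_cluster)
    moreover have "card (\<Union>w'\<in>W - {w}. bad w w') \<le> (\<Sum>w'\<in>W - {w}. card (bad w w'))"
      by (rule card_UN_le) (simp add: finW)
    moreover have "(\<Sum>w'\<in>W - {w}. int (card (bad w w'))) \<le> int H * (K * R)"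
    proof -
      have "(\<Sum>w'\<in>W - {w}. int (card (bad w w'))) \<le> (\<Sum>w'\<in>W - {w}. K * R)"
        using w by (intro sum_mono bad_card) auto
      \<comment> \<open>Only the other members of \<open>W\<close> cause deletions; \<open>w\<close>
        itself is added to get the factor \<open>H\<close>, which is harmless as
        \<open>K * R\<close> is nonnegative.\<close>
      also have "\<dots> \<le> (\<Sum>w'\<in>W. K * R)"
        using R_nonneg finW by (intro sum_mono2) (auto simp: K_def)
      finally show ?thesis by (simp add: W(2))
    qed
    ultimately show ?thesis by (simp flip: of_nat_sum)
  qed
  \<comment> \<open>Deletion from the cluster of \<open>w\<close> alone suffices: a product of at
    least \<open>t\<close> would already put \<open>x\<close> into \<open>bad w w'\<close>.\<close>
  have across: "dot n x y < t"
    if "w \<in> W" "w' \<in> W" "w \<noteq> w'" "x \<in> good w" "y \<in> good w'" for w w' x y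
  proof (rule ccontr)
    assume "\<not> dot n x y < t"
    moreover have "x \<in> cluster n mm w" "y \<in> cluster n mm w'" using that by (auto simp: good_def)
    ultimately have "x \<in> bad w w'"
      using dot_between_clusters[of x n mm w y w'] by (auto simp: bad_def T_def)
    then show False using that by (auto simp: good_def)
  qed
  have within: "t < dot n x y" if "w \<in> W" "x \<in> good w" "y \<in> good w" for w x y
  proof -
    have "w \<in> V n (m (-1)) (m 0) (m 1)" "x \<in> cluster n mm w" "y \<in> cluster n mm w"
      using that W(1) by (auto simp: good_def)
    from dot_within_cluster[OF this(1) col_sums this(2,3)] mdp_sum show ?thesis by linarith
  qed

  define U where "U = (\<Union>w\<in>W. good w)"
  have "U \<subseteq> V n (k (-1)) (k 0) (k 1)"
    using cluster_subset_V[OF w_val row_sums] by (auto simp: U_def good_def)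
  moreover have "\<forall>x\<in>U. \<forall>y\<in>U. x \<noteq> y \<longrightarrow> dot n x y \<noteq> t"
  proof (intro ballI impI)
    fix x y assume "x \<in> U" "y \<in> U"
    then obtain w w' where ww: "w \<in> W" "w' \<in> W" "x \<in> good w" "y \<in> good w'"
      by (auto simp: U_def)
    then show "dot n x y \<noteq> t"
      using across[of w w' x y] within[of w x y] by (cases "w = w'") auto
  qed
  ultimately have U_le: "card U \<le> max_avoiding n (k (-1)) (k 0) (k 1) t"
    unfolding max_avoiding_def by (intro Max_ge finite_cards) blast
  have "card U = (\<Sum>w\<in>W. card (good w))"
    unfolding U_def
  proof (rule card_UN_disjoint[OF finW])
    show "\<forall>w\<in>W. finite (good w)" by (simp add: good_def finite_cluster)
    show "\<forall>w\<in>W. \<forall>w'\<in>W. w \<noteq> w' \<longrightarrow> good w \<inter> good w' = {}"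
    proof (intro ballI impI)
      fix w w' assume ww: "w \<in> W" "w' \<in> W" "w \<noteq> w'"
      \<comment> \<open>A common element \<open>x\<close> would have \<open>dot n x x\<close> both
        below \<open>t\<close> by \<open>across\<close> and above \<open>t\<close> by
        \<open>within\<close>.\<close>
      have False if "x \<in> good w" "x \<in> good w'" for x
        using across[OF ww that] within[OF ww(1) that(1,1)] by simp
      then show "good w \<inter> good w' = {}" by blast
    qed
  qed
  moreover have "(\<Sum>w\<in>W. P - int H * (K * R)) \<le> (\<Sum>w\<in>W. int (card (good w)))"
    by (intro sum_mono good_card)
  ultimately have "int H * (P - int H * (K * R)) \<le> int (max_avoiding n (k (-1)) (k 0) (k 1) t)"
    using U_le by (simp add: W(2) flip: of_nat_sum)
  then show ?thesis
    unfolding H_def[symmetric] P_def[symmetric] by (simp only: K_def mult.assoc)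
qed

end
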